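(* Suppose that Assumptions A, B, C (spelled out in the context) hold and $L<\gamma_{\min}\leq\gamma_k\leq\gamma_{\max}<\infty$ for all $k\geq0$. Moreover, suppose that $0\leq\sigma<(\gamma_{\min}-L)/\gamma_{\min}$ if criterion (SC1) is used, and that $0\leq\sigma<(\gamma_{\min}-L)/\gamma_{\max}$ if criterion (SC2) is used. Let $\{\bm{x}^k\}$ be an infinite sequence generated by the iBPDCA with (SC1) or with (SC2). Then any cluster point $\bm{x}^*$ of $\{\bm{x}^k\}$ is a stationary point of the problem $\min_{\bm{x}\in\mathcal{Q}} f(\bm{x})+P_1(\bm{x})-P_2(\bm{x})$, i.e. $$0\in\partial(\iota_{\mathcal{Q}}+P_1)(\bm{x}^* )-\partial P_2(\bm{x}^* )+\nabla f(\bm{x}^* ).$$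
   Context: Setting. $\mathbb{E}$ is a real finite-dimensional Euclidean space with inner product $\langle\cdot,\cdot\rangle$ and induced norm $\|\cdot\|$; $\mathcal{Q}\subseteq\mathbb{E}$ is a closed convex set with nonempty interior; the problem is $\min_{\bm{x}\in\mathcal{Q}} f(\bm{x})+P_1(\bm{x})-P_2(\bm{x})$. $\iota_{\mathcal{Q}}$ is the indicator function of $\mathcal{Q}$ ($0$ on $\mathcal{Q}$, $+\infty$ elsewhere). For a proper closed convex function $h$, $\bm{x}\in\mathrm{dom}\,h$ and $\varepsilon\ge 0$, $\partial_\varepsilon h(\bm{x})=\{\bm{d}: h(\bm{y})\ge h(\bm{x})+\langle\bm{d},\bm{y}-\bm{x}\rangle-\varepsilon\ \forall\bm{y}\in\mathbb{E}\}$ and $\partial h=\partial_0 h$. Kernel and Bregman distance. $\phi:\mathbb{E}\to(-\infty,\infty]$ is a proper closed kernel function, and $\mathcal{D}_\phi(\bm{x},\bm{y})=\phi(\bm{x})-\phi(\bm{y})-\langle\nabla\phi(\bm{y}),\bm{x}-\bm{y}\rangle$ for $\bm{x}\in\mathrm{dom}\,\phi$, $\bm{y}\in\mathrm{int}\,\mathrm{dom}\,\phi$. A function $h$ is essentially smooth if $\mathrm{int}\,\mathrm{dom}\,h\neq\emptyset$, $h$ is differentiable on $\mathrm{int}\,\mathrm{dom}\,h$, and $\|\nabla h(\bm{x}^k)\|\to\infty$ for every sequence in $\mathrm{int}\,\mathrm{dom}\,h$ converging to a boundary point of $\mathrm{int}\,\mathrm{dom}\,h$. For a closed set $\mathcal{X}$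 with $\mathcal{X}\cap\mathrm{int}\,\mathrm{dom}\,\phi\ne\emptyset$, $(f,\phi)$ is $L$-smooth adaptable restricted on $\mathcal{X}$ ($L\ge 0$) if $|f(\bm{y})-f(\bm{x})-\langle\nabla f(\bm{x}),\bm{y}-\bm{x}\rangle|\le L\mathcal{D}_\phi(\bm{y},\bm{x})$ for all $\bm{x}\in\mathcal{X}\cap\mathrm{int}\,\mathrm{dom}\,\phi$ and $\bm{y}\in\mathcal{X}\cap\mathrm{dom}\,\phi$. Assumption A. (A1) $\phi$ is essentially smooth and strictly convex on $\mathrm{dom}\,\phi$, and $\overline{\mathrm{dom}\,\phi}=\mathcal{Q}$. (A2) $P_1:\mathbb{E}\to(-\infty,\infty]$ is proper closed convex with $\mathrm{dom}\,P_1\cap\mathrm{int}\,\mathcal{Q}\ne\emptyset$; $P_2:\mathbb{E}\to\mathbb{R}$ is continuous and convex. (A3) $f:\mathbb{E}\to(-\infty,\infty]$ is proper closed (possibly nonconvex) with $\mathrm{dom}\,f\supseteq\mathrm{dom}\,\phi$, $f$ is continuously differentiable on $\mathrm{int}\,\mathrm{dom}\,f$, and there is a closed set $\mathcal{X}\supseteq\mathrm{dom}\,P_1\cap\mathcal{Q}$ such that $(f,\phi)$ is $L$-smooth adaptable restricted on $\mathcal{X}$. (A4) $F:=\iota_{\mathcal{Q}}+P_1-P_2+f$ is level-bounded: $\{\bm{x}: F(\bm{x})\le\alpha\}$ is bounded (possibly empty) for every $\alpha\in\mathbb{R}$. (A5) For each subproblem $\min_{\bm{x}} P_1(\bm{x})+\langle\nabla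 f(\bm{x}^k)-\bm{\xi}^k,\bm{x}-\bm{x}^k\rangle+\gamma_k\mathcal{D}_\phi(\bm{x},\bm{x}^k)$ of the algorithm below, the set of optimal solutions is nonempty and contained in $\mathrm{int}\,\mathrm{dom}\,\phi$. Assumption B. $f$ is continuously differentiable on an open set $\mathcal{N}_f$ containing $\mathrm{dom}\,P_1\cap\mathcal{Q}$. Assumption C. There is an open set $\mathcal{N}_\phi$ with $\mathrm{dom}\,P_1\cap\mathcal{Q}\subseteq\mathcal{N}_\phi\subseteq\mathrm{int}\,\mathrm{dom}\,\phi$ such that (C1) $\phi$ is $\mu$-strongly convex on $\mathcal{N}_\phi$ (for some $\mu>0$); (C2) $\phi$ is differentiable on $\mathcal{N}_\phi$ and $\nabla\phi$ is Lipschitz continuous on any bounded subset of $\mathcal{N}_\phi$. Algorithm (iBPDCA). Choose $\bm{x}^0\in\mathrm{dom}\,P_1\cap\mathrm{int}\,\mathrm{dom}\,\phi$, parameters $\{\gamma_k\}$ and $\sigma$ as in the claim, and, for (SC2), also $\bm{x}^{-1}\in\mathrm{int}\,\mathrm{dom}\,\phi$. For $k=0,1,2,\dots$: take any $\bm{\xi}^k\in\partial P_2(\bm{x}^k)$ and find $\bm{x}^{k+1}\in\mathrm{dom}\,P_1\cap\mathrm{int}\,\mathrm{dom}\,\phi$, $\Delta^k\in\mathbb{E}$ and $\delta_k\ge0$ such that $$\Delta^k\in\partial_{\delta_k}P_1(\bm{x}^{k+1})+\nabla f(\bm{x}^k)-\bm{\xi}^k+\gamma_k\big(\nabla\phi(\bm{x}^{k+1})-\nabla\phi(\bm{x}^k)\big)$$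 and the chosen relative stopping criterion holds (the same criterion being used at every iteration): (SC1) $\|\Delta^k\|^2+|\langle\Delta^k,\bm{x}^{k+1}-\bm{x}^k\rangle|+\delta_k\le\sigma\gamma_k\mathcal{D}_\phi(\bm{x}^{k+1},\bm{x}^k)$; (SC2) $\|\Delta^k\|^2+|\langle\Delta^k,\bm{x}^{k+1}-\bm{x}^k\rangle|+\delta_k\le\sigma\gamma_k\mathcal{D}_\phi(\bm{x}^k,\bm{x}^{k-1})$. *)

theory Defs
  imports "HOL-Analysis.Analysis"
begin

definition eff_dom :: "('a \<Rightarrow> ereal) \<Rightarrow> 'a set" where
  "eff_dom h = {x. h x < \<infinity>}"

definition ereal_epigraph :: "('a \<Rightarrow> ereal) \<Rightarrow> ('a \<times> real) set" where
  "ereal_epigraph h = {(x, r). h x \<le> ereal r}"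

definition proper_fun :: "('a \<Rightarrow> ereal) \<Rightarrow> bool" where
  "proper_fun h \<longleftrightarrow> (\<forall>x. h x \<noteq> -\<infinity>) \<and> eff_dom h \<noteq> {}"

definition closed_fun :: "('a::euclidean_space \<Rightarrow> ereal) \<Rightarrow> bool" where
  "closed_fun h \<longleftrightarrow> closed (ereal_epigraph h)"

definition convex_fun :: "('a::euclidean_space \<Rightarrow> ereal) \<Rightarrow> bool" where
  "convex_fun h \<longleftrightarrow> convex (ereal_epigraph h)"

(* The inequality forces the open segment between two points of S to lie in eff_dom h
   whenever S is contained in eff_dom h. *)
definition strictly_convex_on :: "'a::euclidean_space set \<Rightarrow> ('a \<Rightarrow> ereal) \<Rightarrow> bool" where
  "strictly_convex_on S h \<longleftrightarrow>
     (\<forall>x\<in>S. \<forall>y\<in>S. \<forall>t::real. x \<noteq> y \<longrightarrow> 0 < t \<longrightarrow> t < 1 \<longrightarrow>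
        h ((1 - t) *\<^sub>R x + t *\<^sub>R y) < ereal (1 - t) * h x + ereal t * h y)"

(* S need not be convex: h is defined on the whole space, so the inequality makes sense
   for all pairs of points of S. *)
definition strongly_convex_on :: "real \<Rightarrow> 'a::euclidean_space set \<Rightarrow> ('a \<Rightarrow> ereal) \<Rightarrow> bool" where
  "strongly_convex_on \<mu> S h \<longleftrightarrow>
     (\<forall>x\<in>S. \<forall>y\<in>S. \<forall>t::real. 0 \<le> t \<longrightarrow> t \<le> 1 \<longrightarrow>
        h ((1 - t) *\<^sub>R x + t *\<^sub>R y)
          \<le> ereal (1 - t) * h x + ereal t * h y - ereal (\<mu> / 2 * t * (1 - t) * (norm (x - y))\<^sup>2))"

(* real_of_ereal sends infinity to 0, so a derivative of real_of_ereal o h is a derivative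
   of h only at interior points of eff_dom h; differentiable_fun includes that requirement. *)
definition differentiable_fun :: "('a::euclidean_space \<Rightarrow> ereal) \<Rightarrow> 'a \<Rightarrow> bool" where
  "differentiable_fun h x \<longleftrightarrow>
     x \<in> interior (eff_dom h) \<and> (\<exists>g. GDERIV (\<lambda>z. real_of_ereal (h z)) x :> g)"

definition gradient :: "('a::euclidean_space \<Rightarrow> ereal) \<Rightarrow> 'a \<Rightarrow> 'a" where
  "gradient h x = (THE g. GDERIV (\<lambda>z. real_of_ereal (h z)) x :> g)"

definition cont_differentiable_on :: "'a::euclidean_space set \<Rightarrow> ('a \<Rightarrow> ereal) \<Rightarrow> bool" where
  "cont_differentiable_on S h \<longleftrightarrow>
     (\<forall>x\<in>S. differentiable_fun h x) \<and> continuous_on S (gradient h)"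

definition essentially_smooth :: "('a::euclidean_space \<Rightarrow> ereal) \<Rightarrow> bool" where
  "essentially_smooth h \<longleftrightarrow>
     interior (eff_dom h) \<noteq> {} \<and>
     (\<forall>x\<in>interior (eff_dom h). differentiable_fun h x) \<and>
     (\<forall>(u::nat \<Rightarrow> 'a) b. (\<forall>k. u k \<in> interior (eff_dom h)) \<longrightarrow>
        b \<in> frontier (interior (eff_dom h)) \<longrightarrow> u \<longlonglongrightarrow> b \<longrightarrow>
        filterlim (\<lambda>k. norm (gradient h (u k))) at_top sequentially)"

definition eps_subdiff :: "real \<Rightarrow> ('a::euclidean_space \<Rightarrow> ereal) \<Rightarrow> 'a \<Rightarrow> 'a set" where
  "eps_subdiff \<epsilon> h x =
     {d. x \<in> eff_dom h \<and> (\<forall>y. h y \<ge> h x + ereal (d \<bullet> (y - x)) - ereal \<epsilon>)}"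

abbreviation subdiff :: "('a::euclidean_space \<Rightarrow> ereal) \<Rightarrow> 'a \<Rightarrow> 'a set" where
  "subdiff \<equiv> eps_subdiff 0"

definition indicator_fun :: "'a set \<Rightarrow> 'a \<Rightarrow> ereal" where
  "indicator_fun S x = (if x \<in> S then 0 else \<infinity>)"

(* Meaningful for y in the interior of eff_dom \<phi>. It takes the value infinity for x outside
   eff_dom \<phi>, as is needed in the subproblem objective below. *)
definition bregman :: "('a::euclidean_space \<Rightarrow> ereal) \<Rightarrow> 'a \<Rightarrow> 'a \<Rightarrow> ereal" where
  "bregman \<phi> x y = \<phi> x - \<phi> y - ereal (gradient \<phi> y \<bullet> (x - y))"

definition smooth_adaptable ::
  "real \<Rightarrow> ('a::euclidean_space \<Rightarrow> ereal) \<Rightarrow> ('a \<Rightarrow> ereal) \<Rightarrow> 'a set \<Rightarrow> bool" where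
  "smooth_adaptable L f \<phi> X \<longleftrightarrow>
     0 \<le> L \<and> closed X \<and> X \<inter> interior (eff_dom \<phi>) \<noteq> {} \<and>
     (\<forall>x \<in> X \<inter> interior (eff_dom \<phi>). \<forall>y \<in> X \<inter> eff_dom \<phi>.
        \<bar>f y - f x - ereal (gradient f x \<bullet> (y - x))\<bar> \<le> ereal L * bregman \<phi> y x)"

definition level_bounded :: "('a::euclidean_space \<Rightarrow> ereal) \<Rightarrow> bool" where
  "level_bounded F \<longleftrightarrow> (\<forall>\<alpha>::real. bounded {x. F x \<le> ereal \<alpha>})"

definition minimizers :: "('a \<Rightarrow> ereal) \<Rightarrow> 'a set" where
  "minimizers h = {x. \<forall>y. h x \<le> h y}"

definition subproblem_objective ::
  "('a::euclidean_space \<Rightarrow> ereal) \<Rightarrow> ('a \<Rightarrow> ereal) \<Rightarrow> ('a \<Rightarrow> ereal)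
     \<Rightarrow> 'a \<Rightarrow> 'a \<Rightarrow> real \<Rightarrow> 'a \<Rightarrow> ereal" where
  "subproblem_objective f P1 \<phi> xk \<xi> \<gamma> x =
     P1 x + ereal ((gradient f xk - \<xi>) \<bullet> (x - xk)) + ereal \<gamma> * bregman \<phi> x xk"

(* The iteration without its stopping criterion. *)
definition iBPDCA ::
  "('a::euclidean_space \<Rightarrow> ereal) \<Rightarrow> ('a \<Rightarrow> ereal) \<Rightarrow> ('a \<Rightarrow> real) \<Rightarrow> ('a \<Rightarrow> ereal)
     \<Rightarrow> (nat \<Rightarrow> real) \<Rightarrow> (nat \<Rightarrow> 'a) \<Rightarrow> (nat \<Rightarrow> 'a) \<Rightarrow> (nat \<Rightarrow> 'a) \<Rightarrow> (nat \<Rightarrow> real) \<Rightarrow> bool" where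
  "iBPDCA f P1 P2 \<phi> \<gamma> x \<xi> \<Delta> \<delta> \<longleftrightarrow>
     x 0 \<in> eff_dom P1 \<inter> interior (eff_dom \<phi>) \<and>
     (\<forall>k. \<xi> k \<in> subdiff (\<lambda>y. ereal (P2 y)) (x k) \<and>
          x (Suc k) \<in> eff_dom P1 \<inter> interior (eff_dom \<phi>) \<and>
          \<delta> k \<ge> 0 \<and>
          \<Delta> k \<in> (\<lambda>d. d + gradient f (x k) - \<xi> k
                        + \<gamma> k *\<^sub>R (gradient \<phi> (x (Suc k)) - gradient \<phi> (x k)))
                 ` eps_subdiff (\<delta> k) P1 (x (Suc k)))"

definition SC1 ::
  "('a::euclidean_space \<Rightarrow> ereal) \<Rightarrow> real \<Rightarrow> (nat \<Rightarrow> real)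
     \<Rightarrow> (nat \<Rightarrow> 'a) \<Rightarrow> (nat \<Rightarrow> 'a) \<Rightarrow> (nat \<Rightarrow> real) \<Rightarrow> bool" where
  "SC1 \<phi> \<sigma> \<gamma> x \<Delta> \<delta> \<longleftrightarrow>
     (\<forall>k. ereal ((norm (\<Delta> k))\<^sup>2 + \<bar>\<Delta> k \<bullet> (x (Suc k) - x k)\<bar> + \<delta> k)
            \<le> ereal (\<sigma> * \<gamma> k) * bregman \<phi> (x (Suc k)) (x k))"

(* xm1 is the additional starting point with index -1. *)
definition SC2 ::
  "('a::euclidean_space \<Rightarrow> ereal) \<Rightarrow> real \<Rightarrow> (nat \<Rightarrow> real)
     \<Rightarrow> 'a \<Rightarrow> (nat \<Rightarrow> 'a) \<Rightarrow> (nat \<Rightarrow> 'a) \<Rightarrow> (nat \<Rightarrow> real) \<Rightarrow> bool" where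
  "SC2 \<phi> \<sigma> \<gamma> xm1 x \<Delta> \<delta> \<longleftrightarrow>
     xm1 \<in> interior (eff_dom \<phi>) \<and>
     (\<forall>k. ereal ((norm (\<Delta> k))\<^sup>2 + \<bar>\<Delta> k \<bullet> (x (Suc k) - x k)\<bar> + \<delta> k)
            \<le> ereal (\<sigma> * \<gamma> k)
                * bregman \<phi> (x k) (case k of 0 \<Rightarrow> xm1 | Suc j \<Rightarrow> x j))"

definition cluster_point :: "(nat \<Rightarrow> 'a::topological_space) \<Rightarrow> 'a \<Rightarrow> bool" where
  "cluster_point x l \<longleftrightarrow> (\<exists>r::nat \<Rightarrow> nat. strict_mono r \<and> (x \<circ> r) \<longlonglongrightarrow> l)"

definition stationary_point ::
  "'a::euclidean_space set \<Rightarrow> ('a \<Rightarrow> ereal) \<Rightarrow> ('a \<Rightarrow> ereal) \<Rightarrow> ('a \<Rightarrow> real) \<Rightarrow> 'a \<Rightarrow> bool" where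
  "stationary_point Q f P1 P2 x \<longleftrightarrow>
     0 \<in> {u - v + gradient f x | u v.
            u \<in> subdiff (\<lambda>y. indicator_fun Q y + P1 y) x \<and>
            v \<in> subdiff (\<lambda>y. ereal (P2 y)) x}"

end

theory Submission
  imports Defs
begin

text \<open>
  Testing the inexact inclusion at \<open>x\<^sup>k\<close> and adding the subgradient inequality of \<open>P\<^sub>2\<close> and the
  smooth adaptability of \<open>f\<close> gives a descent inequality for \<open>F\<close> with gain proportional to
  \<open>D\<^sub>k = \<D>\<^sub>\<phi>(x\<^bsup>k+1\<^esup>, x\<^sup>k)\<close>. Along a subsequence tending to \<open>x\<^sup>*\<close>, \<open>F\<close> is bounded below because
  \<open>P\<^sub>1\<close> and \<open>f\<close> are closed and proper, which is enough for \<open>D\<^sub>k\<close> to tend to \<open>0\<close>; strong convexity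
  then gives \<open>x\<^bsup>k+1\<^esup> - x\<^sup>k \<longlonglongrightarrow> 0\<close>, and the stopping criterion \<open>\<Delta>\<^sup>k \<longlonglongrightarrow> 0\<close> and \<open>\<delta>\<^sub>k \<longlonglongrightarrow> 0\<close>.
  The boundedness of \<open>F\<close> from above puts \<open>x\<^sup>*\<close> in the domain of \<open>P\<^sub>1\<close>, hence in the open sets where
  \<open>\<nabla>f\<close> is continuous and \<open>\<nabla>\<phi>\<close> locally Lipschitz, and the inclusion passes to the limit since the
  graph of the \<open>\<epsilon>\<close>-subdifferential is closed.
\<close>

text \<open>Lower semicontinuity along sequences, also where \<open>h l\<close> is infinite:
  \<open>(l, c)\<close> lies in the open complement of the epigraph, so \<open>(u k, c)\<close>
  eventually does too.\<close>

lemma closed_fun_eventually_greater: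
  assumes "closed_fun h" "u \<longlonglongrightarrow> l" "ereal c < h l"
  shows "\<forall>\<^sub>F k in sequentially. ereal c < h (u k)"
proof -
  have "(\<lambda>k. (u k, c)) \<longlonglongrightarrow> (l, c)"
    using assms(2) by (intro tendsto_intros)
  moreover have "open (- ereal_epigraph h)" "(l, c) \<in> - ereal_epigraph h"
    using assms by (auto simp: closed_fun_def ereal_epigraph_def)
  ultimately have "\<forall>\<^sub>F k in sequentially. (u k, c) \<in> - ereal_epigraph h"
    by (rule topological_tendstoD)
  then show ?thesis
    by (simp add: ereal_epigraph_def not_le)
qed

lemma closed_fun_le_limit:
  assumes "closed_fun h" "u \<longlonglongrightarrow> l" "r \<longlonglongrightarrow> c" "\<And>k. h (u k) \<le> ereal (r k)"
  shows "h l \<le> ereal c"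
proof -
  have lim: "(\<lambda>k. (u k, r k)) \<longlonglongrightarrow> (l, c)"
    using assms(2,3) by (intro tendsto_intros)
  have "(u k, r k) \<in> ereal_epigraph h" for k
    using assms(4) by (simp add: ereal_epigraph_def)
  then have "(l, c) \<in> ereal_epigraph h"
    by (rule closed_sequentially[OF assms(1)[unfolded closed_fun_def] _ lim])
  then show ?thesis
    by (simp add: ereal_epigraph_def)
qed

lemma closed_fun_of_continuous:
  assumes "continuous_on UNIV (g :: 'a::euclidean_space \<Rightarrow> real)"
  shows "closed_fun (\<lambda>y. ereal (g y))"
proof -
  have "ereal_epigraph (\<lambda>y. ereal (g y)) = {p. g (fst p) \<le> snd p}"
    by (auto simp: ereal_epigraph_def)
  moreover have "closed {p :: 'a \<times> real. g (fst p) \<le> snd p}"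
    by (intro closed_Collect_le continuous_intros continuous_on_compose2[OF assms]) auto
  ultimately show ?thesis
    by (simp add: closed_fun_def)
qed

lemma proper_fun_finite:
  assumes "proper_fun h" "x \<in> eff_dom h"
  shows "h x = ereal (real_of_ereal (h x))"
  using assms by (cases "h x") (auto simp: proper_fun_def eff_dom_def)

text \<open>For a fixed \<open>y\<close> with finite value, the inequality bounds
  \<open>h (u k)\<close> by reals that converge, so the closed epigraph carries the bound over to
  \<open>l\<close>.\<close>

lemma eps_subdiff_closed_graph:
  assumes h: "proper_fun h" "closed_fun h"
    and lim: "u \<longlonglongrightarrow> l" "d \<longlonglongrightarrow> d'" "e \<longlonglongrightarrow> e'"
    and sub: "\<And>k. d k \<in> eps_subdiff (e k) h (u k)"
  shows "d' \<in> eps_subdiff e' h l"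
proof -
  have bound: "h l \<le> ereal (c - d' \<bullet> (y - l) + e')" if y: "h y = ereal c" for y c
  proof (rule closed_fun_le_limit[OF h(2) lim(1)])
    show "(\<lambda>k. c - d k \<bullet> (y - u k) + e k) \<longlonglongrightarrow> c - d' \<bullet> (y - l) + e'"
      by (intro tendsto_intros lim)
    fix k
    have "h (u k) + ereal (d k \<bullet> (y - u k)) - ereal (e k) \<le> ereal c"
      using sub[of k] y unfolding eps_subdiff_def by (auto dest: spec[of _ y])
    then show "h (u k) \<le> ereal (c - d k \<bullet> (y - u k) + e k)"
      by (cases "h (u k)") auto
  qed
  \<comment> \<open>One test point with a finite value already forces \<open>h l\<close> to be
    finite, so \<open>l\<close> need not be assumed to lie in the domain.\<close>
  obtain y0 where "y0 \<in> eff_dom h"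
    using h(1) by (auto simp: proper_fun_def)
  from bound[OF proper_fun_finite[OF h(1) this]] have dom: "l \<in> eff_dom h"
    by (auto simp: eff_dom_def intro: le_less_trans)
  then obtain a where a: "h l = ereal a"
    using proper_fun_finite[OF h(1)] by metis
  have "h l + ereal (d' \<bullet> (y - l)) - ereal e' \<le> h y" for y
    using bound[of y] h(1) a by (cases "h y") (auto simp: proper_fun_def)
  with dom show ?thesis
    by (simp add: eps_subdiff_def)
qed

text \<open>Moving from \<open>u k\<close> a unit distance along \<open>\<xi> k\<close> raises
  \<open>g\<close> by at least \<open>norm (\<xi> k)\<close>, while \<open>g\<close> is bounded on a
  ball containing both points.\<close>

lemma bounded_subgradients:
  fixes g :: "'a::euclidean_space \<Rightarrow> real"
  assumes g: "continuous_on UNIV g" and "bounded (range u)"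
    and sub: "\<And>k. \<xi> k \<in> subdiff (\<lambda>y. ereal (g y)) (u k)"
  shows "bounded (range \<xi>)"
proof -
  obtain R where R: "\<And>k. norm (u k) \<le> R"
    using assms(2) by (auto simp: bounded_iff)
  have "compact (g ` cball 0 (R + 1))"
    by (intro compact_continuous_image compact_cball continuous_on_subset[OF g]) auto
  then obtain M where M: "\<And>y. norm y \<le> R + 1 \<Longrightarrow> \<bar>g y\<bar> \<le> M"
    by (force dest!: compact_imp_bounded simp: bounded_iff)
  have "norm (\<xi> k) \<le> 2 * M" for k
  proof -
    have "norm (u k + sgn (\<xi> k)) \<le> R + 1"
      using R[of k] norm_triangle_ineq[of "u k" "sgn (\<xi> k)"]
      by (auto simp: norm_sgn split: if_splits)
    then have "\<bar>g (u k + sgn (\<xi> k))\<bar> \<le> M" "\<bar>g (u k)\<bar> \<le> M"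
      using M R[of k] by (auto intro: M)
    moreover have "g (u k + sgn (\<xi> k)) \<ge> g (u k) + \<xi> k \<bullet> sgn (\<xi> k)"
      using sub[of k] by (auto simp: eps_subdiff_def dest: spec[of _ "u k + sgn (\<xi> k)"])
    \<comment> \<open>If \<open>\<xi> k = 0\<close> then \<open>sgn\<close> returns 0 and both sides
      vanish.\<close>
    moreover have "\<xi> k \<bullet> sgn (\<xi> k) = norm (\<xi> k)"
      by (cases "\<xi> k = 0") (simp_all add: sgn_div_norm dot_square_norm power2_eq_square)
    ultimately show ?thesis
      by linarith
  qed
  then show ?thesis
    by (auto simp: bounded_iff)
qed

lemma gradient_eqI:
  assumes "GDERIV (\<lambda>z. real_of_ereal (h z)) x :> g"
  shows "gradient h x = g"
  unfolding gradient_def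
proof (rule the_equality)
  show "GDERIV (\<lambda>z. real_of_ereal (h z)) x :> g" by fact
  fix g' assume "GDERIV (\<lambda>z. real_of_ereal (h z)) x :> g'"
  with assms have "(\<lambda>v. v \<bullet> g') = (\<lambda>v. v \<bullet> g)"
    unfolding gderiv_def by (rule has_derivative_unique[rotated])
  then have "(g' - g) \<bullet> (g' - g) = 0"
    by (metis (no_types) inner_diff_right right_minus_eq)
  then show "g' = g" by simp
qed

text \<open>Strong convexity along the segment from \<open>x\<close> to \<open>y\<close>, divided by
  \<open>t\<close>, bounds the difference quotient of \<phi> at \<open>x\<close>; as
  \<open>t\<close> decreases to 0 the quotient tends to the directional derivative in the Bregman
  distance.\<close>

lemma strongly_convex_bregman_ge:
  fixes \<phi> :: "'a::euclidean_space \<Rightarrow> ereal"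
  assumes proper: "proper_fun \<phi>" and strong: "strongly_convex_on \<mu> N \<phi>"
    and xN: "x \<in> N" "differentiable_fun \<phi> x" and yN: "y \<in> N" "y \<in> eff_dom \<phi>"
  shows "ereal (\<mu> / 2 * (norm (y - x))\<^sup>2) \<le> bregman \<phi> y x"
proof -
  define p where "p z = real_of_ereal (\<phi> z)" for z
  define v where "v = y - x"
  have fin: "\<phi> z = ereal (p z)" if "z \<in> eff_dom \<phi>" for z
    using proper_fun_finite[OF proper that] by (simp add: p_def)
  have x: "x \<in> eff_dom \<phi>"
    using xN(2) interior_subset by (auto simp: differentiable_fun_def)
  obtain g where g: "GDERIV p x :> g"
    using xN(2) by (auto simp: differentiable_fun_def p_def[abs_def])
  have grad: "gradient \<phi> x = g"
    using g by (intro gradient_eqI) (simp add: p_def[abs_def])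
  have ineq: "(p (x + t *\<^sub>R v) - p x) / t \<le> p y - p x - \<mu> / 2 * (1 - t) * (norm v)\<^sup>2"
    if t: "0 < t" "t < 1" for t
  proof -
    have "\<phi> ((1 - t) *\<^sub>R x + t *\<^sub>R y)
        \<le> ereal (1 - t) * \<phi> x + ereal t * \<phi> y - ereal (\<mu> / 2 * t * (1 - t) * (norm (x - y))\<^sup>2)"
      using strong xN(1) yN(1) t unfolding strongly_convex_on_def by auto
    also have "(1 - t) *\<^sub>R x + t *\<^sub>R y = x + t *\<^sub>R v"
      by (simp add: v_def algebra_simps)
    finally have le: "\<phi> (x + t *\<^sub>R v) \<le>
        ereal ((1 - t) * p x + t * p y - \<mu> / 2 * t * (1 - t) * (norm v)\<^sup>2)"
      by (simp add: fin x yN v_def norm_minus_commute)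
    \<comment> \<open>The segment may leave \<open>N\<close>, so finiteness is read off the
      inequality itself.\<close>
    then have "x + t *\<^sub>R v \<in> eff_dom \<phi>"
      by (auto simp: eff_dom_def intro: le_less_trans)
    with le have "p (x + t *\<^sub>R v) \<le> (1 - t) * p x + t * p y - \<mu> / 2 * t * (1 - t) * (norm v)\<^sup>2"
      by (simp add: fin)
    then have "p (x + t *\<^sub>R v) - p x \<le> (p y - p x - \<mu> / 2 * (1 - t) * (norm v)\<^sup>2) * t"
      by (simp add: algebra_simps)
    then show ?thesis
      using t by (simp add: pos_divide_le_eq)
  qed
  have "((\<lambda>t. p (x + t *\<^sub>R v)) has_derivative (\<lambda>t. (t *\<^sub>R v) \<bullet> g)) (at 0)"
  proof (rule has_derivative_compose[where f = "\<lambda>t. x + t *\<^sub>R v", unfolded o_def])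
    show "((\<lambda>t. x + t *\<^sub>R v) has_derivative (\<lambda>t. t *\<^sub>R v)) (at 0)"
      by (auto intro!: derivative_eq_intros)
    show "(p has_derivative (\<lambda>w. w \<bullet> g)) (at (x + 0 *\<^sub>R v))"
      using g by (simp add: gderiv_def)
  qed
  then have "DERIV (\<lambda>t. p (x + t *\<^sub>R v)) 0 :> v \<bullet> g"
    by (simp add: has_field_derivative_def mult_commute_abs)
  then have "((\<lambda>t. (p (x + t *\<^sub>R v) - p x) / t) \<longlongrightarrow> v \<bullet> g) (at_right 0)"
    by (auto simp: DERIV_def intro: tendsto_within_subset)
  moreover have "((\<lambda>t. p y - p x - \<mu> / 2 * (1 - t) * (norm v)\<^sup>2) \<longlongrightarrow>
      p y - p x - \<mu> / 2 * (1 - 0) * (norm v)\<^sup>2) (at_right 0)"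
    by (intro tendsto_intros)
  moreover have "\<forall>\<^sub>F t in at_right 0. (p (x + t *\<^sub>R v) - p x) / t
      \<le> p y - p x - \<mu> / 2 * (1 - t) * (norm v)\<^sup>2"
    using ineq by (auto simp: eventually_at_right_field intro!: exI[of _ 1])
  ultimately have "v \<bullet> g \<le> p y - p x - \<mu> / 2 * (1 - 0) * (norm v)\<^sup>2"
    by (intro tendsto_le[OF trivial_limit_at_right_real]) auto
  then show ?thesis
    by (simp add: bregman_def fin x yN grad v_def inner_commute)
qed

text \<open>The inequality of \<open>P1\<close> at \<open>y\<close> is tested at \<open>x\<close>,
  that of \<open>P2\<close> at \<open>x\<close> is tested at \<open>y\<close>, and the definition of
  \<Delta> trades \<open>d\<close> for the gradient terms.\<close>

lemma descent_step:
  fixes f P1 \<phi> :: "'a::euclidean_space \<Rightarrow> ereal" and P2 :: "'a \<Rightarrow> real"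
  assumes d: "d \<in> eps_subdiff \<delta> P1 y" and \<xi>: "\<xi> \<in> subdiff (\<lambda>y. ereal (P2 y)) x"
    and \<Delta>: "\<Delta> = d + gradient f x - \<xi> + \<gamma> *\<^sub>R (gradient \<phi> y - gradient \<phi> x)"
    and P1: "P1 x = ereal p" "P1 y = ereal p'" and f: "f x = ereal a" "f y = ereal a'"
    and \<phi>: "\<bar>\<phi> x\<bar> \<noteq> \<infinity>" "\<bar>\<phi> y\<bar> \<noteq> \<infinity>"
    and adapt: "\<bar>f y - f x - ereal (gradient f x \<bullet> (y - x))\<bar> \<le> ereal L * bregman \<phi> y x"
    and breg: "bregman \<phi> y x = ereal D" "0 \<le> bregman \<phi> x y" and \<gamma>: "0 \<le> \<gamma>"
  shows "p' - P2 y + a' \<le> p - P2 x + a + (\<bar>\<Delta> \<bullet> (y - x)\<bar> + \<delta>) - (\<gamma> - L) * D"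
proof -
  obtain q q' where q: "\<phi> x = ereal q" "\<phi> y = ereal q'"
    using \<phi> by auto
  have D: "D = q' - q - gradient \<phi> x \<bullet> (y - x)"
    and D': "0 \<le> q - q' - gradient \<phi> y \<bullet> (x - y)"
    using breg by (simp_all add: bregman_def q)
  \<comment> \<open>The right-hand side is the sum of the two Bregman distances between
    \<open>x\<close> and \<open>y\<close>, and the reverse one is nonnegative.\<close>
  have "D \<le> (gradient \<phi> y - gradient \<phi> x) \<bullet> (y - x)"
    using D' by (simp add: D algebra_simps inner_diff_left inner_diff_right)
  then have 1: "\<gamma> * D \<le> \<gamma> * ((gradient \<phi> y - gradient \<phi> x) \<bullet> (y - x))"
    using \<gamma> by (rule mult_left_mono)
  have "p \<ge> p' + d \<bullet> (x - y) - \<delta>"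
    using d by (auto simp: eps_subdiff_def P1 dest!: spec[of _ x])
  then have 2: "p' \<le> p + d \<bullet> (y - x) + \<delta>"
    by (simp add: inner_diff_right)
  have 3: "P2 y \<ge> P2 x + \<xi> \<bullet> (y - x)"
    using \<xi> by (auto simp: eps_subdiff_def dest!: spec[of _ y])
  have 4: "a' - a - gradient f x \<bullet> (y - x) \<le> L * D"
    using adapt by (simp add: f breg)
  have "\<Delta> \<bullet> (y - x) = d \<bullet> (y - x) + gradient f x \<bullet> (y - x) - \<xi> \<bullet> (y - x)
      + \<gamma> * ((gradient \<phi> y - gradient \<phi> x) \<bullet> (y - x))"
    by (simp add: \<Delta> inner_add_left inner_diff_left)
  with 1 2 3 4 show ?thesis
    by (simp add: left_diff_distrib)
qed

lemma squeeze_zero: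
  fixes u v :: "nat \<Rightarrow> real"
  assumes "v \<longlonglongrightarrow> 0" "\<And>k. 0 \<le> u k" "\<And>k. u k \<le> v k"
  shows "u \<longlonglongrightarrow> 0"
  using assms by (intro tendsto_sandwich[where f = "\<lambda>_. 0" and h = v and g = u]) auto

text \<open>The potential \<open>F (k + 1) + t D k\<close> absorbs the one-step delay of (SC2);
  (SC1) is the case \<open>t = 0\<close>.\<close>

lemma delayed_descent_decseq:
  fixes F D :: "nat \<Rightarrow> real"
  assumes step: "\<And>k. F (k + 2) \<le> F (k + 1) + t * D k - b * D (k + 1)"
    and D: "\<And>k. 0 \<le> D k" and t: "t < b"
  shows "decseq (\<lambda>k. F (k + 1) + t * D k)"
proof (rule decseq_SucI)
  fix k
  have "t * D (k + 1) \<le> b * D (k + 1)"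
    using D t by (intro mult_right_mono) auto
  with step[of k] show "F (Suc k + 1) + t * D (Suc k) \<le> F (k + 1) + t * D k"
    by simp
qed

text \<open>A decreasing potential that is bounded below along a subsequence is bounded below
  everywhere, hence converges; each of its drops is at least
  \<open>(b - t) * D (k + 1)\<close>.\<close>

lemma delayed_descent_tendsto_zero:
  fixes F D :: "nat \<Rightarrow> real"
  assumes step: "\<And>k. F (k + 2) \<le> F (k + 1) + t * D k - b * D (k + 1)"
    and D: "\<And>k. 0 \<le> D k" and t: "0 \<le> t" "t < b"
    and r: "strict_mono (r :: nat \<Rightarrow> nat)" "\<forall>\<^sub>F j in sequentially. m \<le> F (r j)"
  shows "D \<longlonglongrightarrow> 0"
proof -
  define H where "H k = F (k + 1) + t * D k" for k
  have dec: "decseq H"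
    unfolding H_def[abs_def] using step D t(2) by (rule delayed_descent_decseq)
  have lower: "m \<le> H n" for n
  proof -
    obtain J where J: "\<And>j. J \<le> j \<Longrightarrow> m \<le> F (r j)"
      using r(2) by (auto simp: eventually_sequentially)
    \<comment> \<open>Since \<open>r j \<ge> j\<close>, the summand \<open>J\<close> reaches the
      range of the lower bound and \<open>n + 1\<close> gives \<open>r j - 1 \<ge> n\<close>. The
      shift by one reflects the \<open>F (k + 1)\<close> in \<open>H k\<close>.\<close>
    define j where "j = J + n + 1"
    have rj: "n + 1 \<le> r j"
      using strict_mono_imp_increasing[OF r(1), of j] by (simp add: j_def)
    have "m \<le> F (r j)"
      by (rule J) (simp add: j_def)
    also have "\<dots> \<le> H (r j - 1)"
      using rj t(1) D by (simp add: H_def)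
    also have "\<dots> \<le> H n"
      using rj by (intro decseqD[OF dec]) auto
    finally show ?thesis .
  qed
  obtain l where l: "H \<longlonglongrightarrow> l"
    using decseq_convergent[OF dec] lower by metis
  then have "(\<lambda>k. H k - H (Suc k)) \<longlonglongrightarrow> l - l"
    by (intro tendsto_diff LIMSEQ_Suc)
  then have lim: "(\<lambda>k. (H k - H (Suc k)) / (b - t)) \<longlonglongrightarrow> 0"
    using t by (auto intro: tendsto_divide_zero)
  have "(\<lambda>k. D (Suc k)) \<longlonglongrightarrow> 0"
  proof (rule squeeze_zero[OF lim])
    show "D (Suc k) \<le> (H k - H (Suc k)) / (b - t)" for k
      using step[of k] t by (simp add: H_def pos_le_divide_eq algebra_simps)
  qed (rule D)
  then show ?thesis
    by (rule LIMSEQ_imp_Suc)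
qed

text \<open>Supplies real lower bounds at the cluster point, where values are not yet known to be
  finite.\<close>

lemma proper_fun_real_below:
  assumes "proper_fun h"
  obtains c where "ereal c < h x"
proof (cases "h x")
  case (real b)
  then show ?thesis using that[of "b - 1"] by simp
next
  case PInf
  then show ?thesis using that[of 0] by simp
next
  case MInf
  then show ?thesis using assms by (simp add: proper_fun_def)
qed

theorem theorem4p1:
  fixes Q X N\<^sub>f N\<^sub>\<phi> :: "'a::euclidean_space set"
    and f P1 \<phi> :: "'a \<Rightarrow> ereal"
    and P2 :: "'a \<Rightarrow> real"
    and L \<mu> \<sigma> \<gamma>min \<gamma>max :: real
    and \<gamma> \<delta> :: "nat \<Rightarrow> real"
    and x \<xi> \<Delta> :: "nat \<Rightarrow> 'a"
    and xstar :: 'a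
  assumes Q: "closed Q" "convex Q" "interior Q \<noteq> {}"
    and phi: "proper_fun \<phi>" "closed_fun \<phi>"
    and A1: "essentially_smooth \<phi>" "strictly_convex_on (eff_dom \<phi>) \<phi>"
      "closure (eff_dom \<phi>) = Q"
    and A2: "proper_fun P1" "closed_fun P1" "convex_fun P1"
      "eff_dom P1 \<inter> interior Q \<noteq> {}"
      "continuous_on UNIV P2" "convex_on UNIV P2"
    and A3: "proper_fun f" "closed_fun f" "eff_dom \<phi> \<subseteq> eff_dom f"
      "cont_differentiable_on (interior (eff_dom f)) f"
      "closed X" "eff_dom P1 \<inter> Q \<subseteq> X" "smooth_adaptable L f \<phi> X"
    and A4: "level_bounded (\<lambda>y. indicator_fun Q y + P1 y - ereal (P2 y) + f y)"
    and A5: "\<And>k. minimizers (subproblem_objective f P1 \<phi> (x k) (\<xi> k) (\<gamma> k)) \<noteq> {}"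
      "\<And>k. minimizers (subproblem_objective f P1 \<phi> (x k) (\<xi> k) (\<gamma> k))
              \<subseteq> interior (eff_dom \<phi>)"
    and B: "open N\<^sub>f" "eff_dom P1 \<inter> Q \<subseteq> N\<^sub>f" "cont_differentiable_on N\<^sub>f f"
    and C: "open N\<^sub>\<phi>" "eff_dom P1 \<inter> Q \<subseteq> N\<^sub>\<phi>" "N\<^sub>\<phi> \<subseteq> interior (eff_dom \<phi>)"
    and C1: "\<mu> > 0" "strongly_convex_on \<mu> N\<^sub>\<phi> \<phi>"
    and C2: "\<forall>y\<in>N\<^sub>\<phi>. differentiable_fun \<phi> y"
      "\<forall>S. S \<subseteq> N\<^sub>\<phi> \<longrightarrow> bounded S \<longrightarrow> (\<exists>K. K-lipschitz_on S (gradient \<phi>))"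
    and gamma: "L < \<gamma>min" "\<And>k. \<gamma>min \<le> \<gamma> k" "\<And>k. \<gamma> k \<le> \<gamma>max"
    and sigma: "0 \<le> \<sigma>"
    and iterates: "iBPDCA f P1 P2 \<phi> \<gamma> x \<xi> \<Delta> \<delta>"
    and criterion:
      "(SC1 \<phi> \<sigma> \<gamma> x \<Delta> \<delta> \<and> \<sigma> < (\<gamma>min - L) / \<gamma>min)
       \<or> (\<exists>xm1. SC2 \<phi> \<sigma> \<gamma> xm1 x \<Delta> \<delta> \<and> \<sigma> < (\<gamma>min - L) / \<gamma>max)"
    and cluster: "cluster_point x xstar"
  shows "stationary_point Q f P1 P2 xstar"
proof -

  \<comment> \<open>Location of the iterates, finite values and Bregman bounds\<close>
  obtain r where r: "strict_mono r" and lim: "(\<lambda>j. x (r j)) \<longlonglongrightarrow> xstar"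
    using cluster by (auto simp: cluster_point_def o_def)
  have xS: "x k \<in> eff_dom P1" "x k \<in> interior (eff_dom \<phi>)" for k
    using iterates by (cases k; auto simp: iBPDCA_def)+
  have x\<phi>: "x k \<in> eff_dom \<phi>" for k
    using xS(2) interior_subset by blast
  have xQ: "x k \<in> Q" for k
    using x\<phi> closure_subset A1(3) by blast
  have xN: "x k \<in> N\<^sub>\<phi>" "x k \<in> N\<^sub>f" "x k \<in> X" for k
    using xS(1)[of k] xQ[of k] A3(6) B(2) C(2) by auto
  define p where "p k = real_of_ereal (P1 (x k))" for k
  define a where "a k = real_of_ereal (f (x k))" for k
  have p: "P1 (x k) = ereal (p k)" for k
    using proper_fun_finite[OF A2(1) xS(1)] by (simp add: p_def)
  have a: "f (x k) = ereal (a k)" for k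
    using proper_fun_finite[OF A3(1)] x\<phi> A3(3) unfolding a_def by blast
  have \<phi>_fin: "\<bar>\<phi> (x k)\<bar> \<noteq> \<infinity>" for k
    using phi(1) x\<phi>[of k] by (auto simp: proper_fun_def eff_dom_def)
  \<comment> \<open>Both orders of the indices are needed: the forward distance controls the step
    length, and the reverse one must be nonnegative in \<open>descent_step\<close>.\<close>
  have breg_ge: "ereal (\<mu> / 2 * (norm (x i - x j))\<^sup>2) \<le> bregman \<phi> (x i) (x j)" for i j
    using phi(1) C1(2) xN(1) C2(1) x\<phi> by (intro strongly_convex_bregman_ge) auto
  have breg_nonneg: "0 \<le> bregman \<phi> (x i) (x j)" for i j
    using C1(1) by (intro order_trans[OF _ breg_ge]) simp
  define D where "D k = real_of_ereal (bregman \<phi> (x (Suc k)) (x k))" for k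
  have D: "bregman \<phi> (x (Suc k)) (x k) = ereal (D k)" for k
    using \<phi>_fin[of k] \<phi>_fin[of "Suc k"]
    by (cases "\<phi> (x k)"; cases "\<phi> (x (Suc k))") (auto simp: D_def bregman_def)
  have D_ge: "\<mu> / 2 * (norm (x (Suc k) - x k))\<^sup>2 \<le> D k" for k
    using breg_ge[of "Suc k" k] by (simp add: D)
  have D_nonneg: "0 \<le> D k" for k
    using breg_nonneg[of "Suc k" k] by (simp add: D)
  have L: "0 \<le> L"
    using A3(7) by (simp add: smooth_adaptable_def)
  have \<gamma>_pos: "0 < \<gamma>min" "0 < \<gamma> k" "0 < \<gamma>max" for k
    using gamma(1) gamma(2)[of k] gamma(2)[of 0] gamma(3)[of 0] L by linarith+
  have \<delta>: "0 \<le> \<delta> k" and \<xi>: "\<xi> k \<in> subdiff (\<lambda>y. ereal (P2 y)) (x k)" for k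
    using iterates by (auto simp: iBPDCA_def)
  have "\<exists>d. d \<in> eps_subdiff (\<delta> k) P1 (x (Suc k)) \<and>
      \<Delta> k = d + gradient f (x k) - \<xi> k + \<gamma> k *\<^sub>R (gradient \<phi> (x (Suc k)) - gradient \<phi> (x k))" for k
    using iterates unfolding iBPDCA_def by blast
  then obtain d where d: "\<And>k. d k \<in> eps_subdiff (\<delta> k) P1 (x (Suc k))"
    and \<Delta>: "\<And>k. \<Delta> k = d k + gradient f (x k) - \<xi> k
      + \<gamma> k *\<^sub>R (gradient \<phi> (x (Suc k)) - gradient \<phi> (x k))"
    by metis

  \<comment> \<open>Descent inequality under either stopping criterion\<close>
  define F where "F k = p k - P2 (x k) + a k" for k
  \<comment> \<open>The common left-hand side of (SC1) and (SC2). It dominates the error in the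
    descent inequality, and its convergence to 0 forces that of \<Delta> and \<delta>.\<close>
  define e where "e k = (norm (\<Delta> k))\<^sup>2 + \<bar>\<Delta> k \<bullet> (x (Suc k) - x k)\<bar> + \<delta> k" for k
  have e_ge: "0 \<le> e k" "(norm (\<Delta> k))\<^sup>2 \<le> e k" "\<delta> k \<le> e k" for k
    using \<delta>[of k] by (auto simp: e_def)
  have step: "F (Suc k) \<le> F k + e k - (\<gamma> k - L) * D k" for k
  proof -
    have "p (Suc k) - P2 (x (Suc k)) + a (Suc k) \<le> p k - P2 (x k) + a k
        + (\<bar>\<Delta> k \<bullet> (x (Suc k) - x k)\<bar> + \<delta> k) - (\<gamma> k - L) * D k"
    proof (rule descent_step[OF d \<xi> \<Delta> p p a a \<phi>_fin \<phi>_fin _ D breg_nonneg])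
      show "\<bar>f (x (Suc k)) - f (x k) - ereal (gradient f (x k) \<bullet> (x (Suc k) - x k))\<bar>
          \<le> ereal L * bregman \<phi> (x (Suc k)) (x k)"
        using A3(7) xN(3) xS(2) x\<phi> by (auto simp: smooth_adaptable_def)
      show "0 \<le> \<gamma> k"
        using \<gamma>_pos(2) less_imp_le by blast
    qed
    then show ?thesis
      using zero_le_power2[of "norm (\<Delta> k)"] unfolding F_def e_def by linarith
  qed
  \<comment> \<open>Both criteria are brought to one form: \<open>t = 0\<close> for (SC1),
    \<open>t = \<sigma> * \<gamma>max\<close> for (SC2). The descent starts at \<open>F 1\<close>
    because the error of (SC2) at index 0 is measured against \<open>xm1\<close>, outside the
    sequence \<open>D\<close>.\<close>
  obtain t b where t: "0 \<le> t" "t < b"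
    and descent: "\<And>k. F (k + 2) \<le> F (k + 1) + t * D k - b * D (k + 1)"
    and e_lim: "D \<longlonglongrightarrow> 0 \<Longrightarrow> e \<longlonglongrightarrow> 0"
    using criterion
  proof (elim disjE conjE exE)
    assume SC: "SC1 \<phi> \<sigma> \<gamma> x \<Delta> \<delta>" and \<sigma>: "\<sigma> < (\<gamma>min - L) / \<gamma>min"
    have e_le: "e k \<le> \<sigma> * \<gamma> k * D k" for k
      using SC by (simp add: SC1_def e_def D)
    have \<sigma>': "\<sigma> * \<gamma>min < \<gamma>min - L"
      using \<sigma> \<gamma>_pos(1) by (simp add: pos_less_divide_eq)
    then have "\<sigma> * \<gamma>min < 1 * \<gamma>min"
      using L by linarith
    \<comment> \<open>This makes \<open>(1 - \<sigma>) * \<gamma> k\<close> increasing in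
      \<open>\<gamma> k\<close>, so that \<open>\<gamma>min\<close> may replace
      \<open>\<gamma> k\<close>.\<close>
    then have \<sigma>1: "\<sigma> < 1"
      using \<gamma>_pos(1) mult_less_cancel_right_pos by blast
    show thesis
    proof (rule that[of 0 "(1 - \<sigma>) * \<gamma>min - L"])
      show "0 < (1 - \<sigma>) * \<gamma>min - L"
        using \<sigma>' by (simp add: algebra_simps)
      fix k
      have "(1 - \<sigma>) * \<gamma>min \<le> (1 - \<sigma>) * \<gamma> (Suc k)"
        using \<sigma>1 gamma(2) by (intro mult_left_mono) auto
      then have "((1 - \<sigma>) * \<gamma>min - L) * D (Suc k) \<le> ((1 - \<sigma>) * \<gamma> (Suc k) - L) * D (Suc k)"
        using D_nonneg by (intro mult_right_mono) auto
      with step[of "Suc k"] e_le[of "Suc k"]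
      show "F (k + 2) \<le> F (k + 1) + 0 * D k - ((1 - \<sigma>) * \<gamma>min - L) * D (k + 1)"
        by (simp add: algebra_simps)
    next
      assume D0: "D \<longlonglongrightarrow> 0"
      have "(\<lambda>k. \<sigma> * \<gamma>max * D k) \<longlonglongrightarrow> 0"
        using D0 by (rule tendsto_mult_right_zero)
      moreover have "e k \<le> \<sigma> * \<gamma>max * D k" for k
        using sigma gamma(3) D_nonneg
        by (intro order_trans[OF e_le] mult_right_mono mult_left_mono) auto
      ultimately show "e \<longlonglongrightarrow> 0"
        using e_ge(1) squeeze_zero by blast
    qed simp
  next
    fix xm1 assume SC: "SC2 \<phi> \<sigma> \<gamma> xm1 x \<Delta> \<delta>" and \<sigma>: "\<sigma> < (\<gamma>min - L) / \<gamma>max"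
    have e_le: "e (Suc k) \<le> \<sigma> * \<gamma>max * D k" for k
    proof -
      have "e (Suc k) \<le> \<sigma> * \<gamma> (Suc k) * D k"
        using SC unfolding SC2_def by (auto simp: e_def D dest!: spec[of _ "Suc k"])
      \<comment> \<open>The error carries \<open>\<gamma> (Suc k)\<close>, but the gain in
        \<open>D k\<close> was obtained with \<open>\<gamma> k\<close>. The two are not comparable,
        hence the division by \<open>\<gamma>max\<close> in the bound on \<sigma>.\<close>
      also have "\<dots> \<le> \<sigma> * \<gamma>max * D k"
        using sigma gamma(3) D_nonneg by (intro mult_right_mono mult_left_mono) auto
      finally show ?thesis .
    qed
    show thesis
    proof (rule that[of "\<sigma> * \<gamma>max" "\<gamma>min - L"])
      show "0 \<le> \<sigma> * \<gamma>max"
        using sigma \<gamma>_pos(3) by simp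
      show "\<sigma> * \<gamma>max < \<gamma>min - L"
        using \<sigma> \<gamma>_pos(3) by (simp add: pos_less_divide_eq)
      fix k
      have "(\<gamma>min - L) * D (Suc k) \<le> (\<gamma> (Suc k) - L) * D (Suc k)"
        using gamma(2) D_nonneg by (intro mult_right_mono) auto
      with step[of "Suc k"] e_le[of k]
      show "F (k + 2) \<le> F (k + 1) + \<sigma> * \<gamma>max * D k - (\<gamma>min - L) * D (k + 1)"
        by simp
    next
      assume D0: "D \<longlonglongrightarrow> 0"
      have "(\<lambda>k. \<sigma> * \<gamma>max * D k) \<longlonglongrightarrow> 0"
        using D0 by (rule tendsto_mult_right_zero)
      then have "(\<lambda>k. e (Suc k)) \<longlonglongrightarrow> 0"
        by (rule squeeze_zero[OF _ e_ge(1) e_le])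
      then show "e \<longlonglongrightarrow> 0"
        by (rule LIMSEQ_imp_Suc)
    qed
  qed

  \<comment> \<open>Lower bound on \<open>F\<close> along the subsequence; the Bregman distances
    vanish\<close>
  obtain \<alpha> \<beta> where \<alpha>: "ereal \<alpha> < P1 xstar" and \<beta>: "ereal \<beta> < f xstar"
    using proper_fun_real_below[OF A2(1)] proper_fun_real_below[OF A3(1)] by metis
  have p_ev: "\<forall>\<^sub>F j in sequentially. \<alpha> < p (r j)"
    using closed_fun_eventually_greater[OF A2(2) lim \<alpha>] by (simp add: p)
  have a_ev: "\<forall>\<^sub>F j in sequentially. \<beta> < a (r j)"
    using closed_fun_eventually_greater[OF A3(2) lim \<beta>] by (simp add: a)
  have P2_lim: "(\<lambda>j. P2 (x (r j))) \<longlonglongrightarrow> P2 xstar"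
    using A2(5) lim by (rule continuous_on_tendsto_compose) auto
  then have P2_ev: "\<forall>\<^sub>F j in sequentially. P2 (x (r j)) < P2 xstar + 1"
    by (rule order_tendstoD) simp
  have "\<forall>\<^sub>F j in sequentially. \<alpha> - (P2 xstar + 1) + \<beta> \<le> F (r j)"
    using p_ev a_ev P2_ev by eventually_elim (simp add: F_def)
  then have D0: "D \<longlonglongrightarrow> 0"
    using delayed_descent_tendsto_zero[OF descent D_nonneg t r] by blast
  note e0 = e_lim[OF D0]

  \<comment> \<open>The cluster point lies in the domain of \<open>P1\<close>\<close>
  have F_le: "F k \<le> max (F 0) (F 1 + t * D 0)" for k
  \<comment> \<open>The potential starts at \<open>F 1\<close>, so \<open>F 0\<close> enters the
    bound separately.\<close>
  proof (cases k)
    case (Suc n)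
    have "F (n + 1) + t * D n \<le> F (0 + 1) + t * D 0"
      using decseqD[OF delayed_descent_decseq[OF descent D_nonneg t(2)], of 0 n] by simp
    moreover have "0 \<le> t * D n"
      using t(1) D_nonneg by simp
    ultimately show ?thesis
      using Suc by simp
  qed simp
  \<comment> \<open>Obtained by solving \<open>F = p - P2 + a\<close> for \<open>p\<close> with the
    bounds on \<open>F\<close>, \<open>P2\<close> and \<open>a\<close>. A value
    \<open>P1 xstar\<close> above \<open>M\<close> would push \<open>p (r j)\<close> above
    \<open>M\<close> as well.\<close>
  define M where "M = max (F 0) (F 1 + t * D 0) + (P2 xstar + 1) - \<beta>"
  have "\<forall>\<^sub>F j in sequentially. p (r j) < M"
    using a_ev P2_ev
  proof eventually_elim
    case (elim j)
    then show ?case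
      using F_le[of "r j"] by (simp add: F_def M_def)
  qed
  moreover have "\<forall>\<^sub>F j in sequentially. M < p (r j)" if "ereal M < P1 xstar"
    using closed_fun_eventually_greater[OF A2(2) lim that] by (simp add: p)
  ultimately have "\<not> ereal M < P1 xstar"
    using eventually_happens'[OF sequentially_bot eventually_conj] less_asym by metis
  then have xs1: "xstar \<in> eff_dom P1"
    by (auto simp: eff_dom_def not_less intro: le_less_trans)
  have xsQ: "xstar \<in> Q"
    using Q(1) xQ lim by (metis closed_sequentially)
  have xsN: "xstar \<in> N\<^sub>f" "xstar \<in> N\<^sub>\<phi>"
    using xs1 xsQ B(2) C(2) by auto

  \<comment> \<open>Steps and inexactness terms vanish\<close>
  have "(\<lambda>k. (norm (x (Suc k) - x k))\<^sup>2) \<longlonglongrightarrow> 0"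
  proof (rule squeeze_zero)
    show "(\<lambda>k. 2 / \<mu> * D k) \<longlonglongrightarrow> 0"
      using D0 by (rule tendsto_mult_right_zero)
    show "(norm (x (Suc k) - x k))\<^sup>2 \<le> 2 / \<mu> * D k" for k
      using D_ge[of k] C1(1) by (simp add: field_simps)
  qed simp
  then have "(\<lambda>k. sqrt ((norm (x (Suc k) - x k))\<^sup>2)) \<longlonglongrightarrow> sqrt 0"
    by (rule tendsto_real_sqrt)
  then have diff: "(\<lambda>k. x (Suc k) - x k) \<longlonglongrightarrow> 0"
    by (simp add: tendsto_norm_zero_iff)
  have "(\<lambda>k. (norm (\<Delta> k))\<^sup>2) \<longlonglongrightarrow> 0"
    by (rule squeeze_zero[OF e0 zero_le_power2 e_ge(2)])
  then have "(\<lambda>k. sqrt ((norm (\<Delta> k))\<^sup>2)) \<longlonglongrightarrow> sqrt 0"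
    by (rule tendsto_real_sqrt)
  then have \<Delta>0: "\<Delta> \<longlonglongrightarrow> 0"
    by (simp add: tendsto_norm_zero_iff)
  have \<delta>0: "\<delta> \<longlonglongrightarrow> 0"
    by (rule squeeze_zero[OF e0 \<delta> e_ge(3)])

  \<comment> \<open>A further subsequence along which the subgradients of \<open>P2\<close>
    converge\<close>
  have "bounded (range (\<lambda>j. \<xi> (r j)))"
    using A2(5) convergent_imp_bounded[OF lim] \<xi> by (rule bounded_subgradients)
  then obtain \<xi>' s where s: "strict_mono s" and \<xi>_lim: "(\<lambda>j. \<xi> (r (s j))) \<longlonglongrightarrow> \<xi>'"
    using bounded_imp_convergent_subsequence[of "\<lambda>j. \<xi> (r j)"] by (auto simp: o_def)
  define q where "q j = r (s j)" for j
  have q: "strict_mono q"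
    using r s by (simp add: q_def strict_mono_def)
  have xq: "(\<lambda>j. x (q j)) \<longlonglongrightarrow> xstar"
    using LIMSEQ_subseq_LIMSEQ[OF lim s] by (simp add: o_def q_def)
  \<comment> \<open>The shifted sequence is needed because \<open>d k\<close> is an approximate
    subgradient at \<open>x (Suc k)\<close>, whereas \<open>\<xi> k\<close> and the gradient of
    \<open>f\<close> are taken at \<open>x k\<close>.\<close>
  have xq': "(\<lambda>j. x (Suc (q j))) \<longlonglongrightarrow> xstar"
    using tendsto_add[OF xq LIMSEQ_subseq_LIMSEQ[OF diff q, unfolded o_def]] by simp
  have \<xi>': "\<xi>' \<in> subdiff (\<lambda>y. ereal (P2 y)) xstar"
    by (rule eps_subdiff_closed_graph[OF _ closed_fun_of_continuous[OF A2(5)] xq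
      \<xi>_lim[folded q_def] tendsto_const \<xi>]) (auto simp: proper_fun_def eff_dom_def)

  \<comment> \<open>Passage to the limit in the inclusion\<close>
  define S where "S = range (\<lambda>j. x (q j)) \<union> range (\<lambda>j. x (Suc (q j)))"
  \<comment> \<open>Boundedness of both sequences together yields one Lipschitz constant for all
    \<open>j\<close>.\<close>
  have "S \<subseteq> N\<^sub>\<phi>" "bounded S"
    using xN(1) convergent_imp_bounded[OF xq] convergent_imp_bounded[OF xq']
    by (auto simp: S_def)
  then obtain K where K: "K-lipschitz_on S (gradient \<phi>)"
    using C2(2) by blast
  have "(\<lambda>j. gradient \<phi> (x (Suc (q j))) - gradient \<phi> (x (q j))) \<longlonglongrightarrow> 0"
  proof (rule Lim_null_comparison)
    have "norm (gradient \<phi> (x (Suc (q j))) - gradient \<phi> (x (q j)))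
        \<le> K * norm (x (Suc (q j)) - x (q j))" for j
      using lipschitz_onD[OF K, of "x (Suc (q j))" "x (q j)"] by (auto simp: S_def dist_norm)
    then show "\<forall>\<^sub>F j in sequentially. norm (gradient \<phi> (x (Suc (q j))) - gradient \<phi> (x (q j)))
        \<le> K * norm (x (Suc (q j)) - x (q j))"
      by simp
    show "(\<lambda>j. K * norm (x (Suc (q j)) - x (q j))) \<longlonglongrightarrow> 0"
      using LIMSEQ_subseq_LIMSEQ[OF diff q, unfolded o_def]
      by (intro tendsto_mult_right_zero tendsto_norm_zero)
  qed
  \<comment> \<open>The parameters need not converge; bounded times null is still null.\<close>
  moreover have "Bfun (\<lambda>j. \<gamma> (q j)) sequentially"
    using \<gamma>_pos(2) gamma(3) by (intro BfunI[of _ \<gamma>max]) (simp add: less_imp_le)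
  ultimately have grad\<phi>: "(\<lambda>j. \<gamma> (q j) *\<^sub>R
      (gradient \<phi> (x (Suc (q j))) - gradient \<phi> (x (q j)))) \<longlonglongrightarrow> 0"
    unfolding tendsto_Zfun_iff diff_zero
    by (intro bounded_bilinear.Bfun_prod_Zfun[OF bounded_bilinear_scaleR])
  have gradf: "(\<lambda>j. gradient f (x (q j))) \<longlonglongrightarrow> gradient f xstar"
    using B(3) xsN(1) xN(2) unfolding cont_differentiable_on_def
    by (intro continuous_on_tendsto_compose[OF _ xq, of N\<^sub>f]) auto
  have "d k = \<Delta> k - gradient f (x k) + \<xi> k
      - \<gamma> k *\<^sub>R (gradient \<phi> (x (Suc k)) - gradient \<phi> (x k))" for k
    by (simp add: \<Delta>)
  moreover have "(\<lambda>j. \<Delta> (q j) - gradient f (x (q j)) + \<xi> (q j)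
      - \<gamma> (q j) *\<^sub>R (gradient \<phi> (x (Suc (q j))) - gradient \<phi> (x (q j))))
      \<longlonglongrightarrow> 0 - gradient f xstar + \<xi>' - 0"
    by (intro tendsto_intros LIMSEQ_subseq_LIMSEQ[OF \<Delta>0 q, unfolded o_def] gradf
      \<xi>_lim[folded q_def] grad\<phi>)
  ultimately have d_lim: "(\<lambda>j. d (q j)) \<longlonglongrightarrow> \<xi>' - gradient f xstar"
    by simp
  have "\<xi>' - gradient f xstar \<in> subdiff P1 xstar"
    by (rule eps_subdiff_closed_graph[OF A2(1,2) xq' d_lim
      LIMSEQ_subseq_LIMSEQ[OF \<delta>0 q, unfolded o_def] d])
  \<comment> \<open>The indicator leaves the value at \<open>xstar\<close> unchanged and can only
    raise the others, so the subgradient inequality persists.\<close>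
  then have "\<xi>' - gradient f xstar \<in> subdiff (\<lambda>y. indicator_fun Q y + P1 y) xstar"
    using xsQ A2(1) by (auto simp: eps_subdiff_def eff_dom_def indicator_fun_def proper_fun_def)
  moreover have "0 = (\<xi>' - gradient f xstar) - \<xi>' + gradient f xstar"
    by simp
  ultimately show ?thesis
    using \<xi>' unfolding stationary_point_def by blast
qed

end
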